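(* For every positive integer $n$, $c_b(G_{2,n})=\left\lceil \frac{n+2}{9}\right\rceil$.
   Context: Bridge-burning Cops and Robbers is played on a finite graph $G$ by a team of cops and a single robber, with full information. First each cop chooses a starting vertex (several cops may share a vertex), then the robber chooses a starting vertex. The game then proceeds in rounds; in each round, first every cop either stays put or moves along an edge of the current graph to an adjacent vertex, and then the robber either stays put or moves along an edge of the current graph. Every edge traversed by the robber is immediately deleted from the graph (cop moves delete nothing). The cops win if at some moment some cop occupies the same vertex as the robber; the robber wins if he avoids this forever. $c_b(G)$ is the minimum number of cops for which the cops have a winning strategy. $G_{2,n}=P_n\,\Box\,P_2$ is the $2\times n$ grid (2 rows, $n$ columns). *)

theory Defs
  imports Complex_Main
begin

record 'v graph =
  verts :: "'v set"
  edges :: "'v set set"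

definition finite_simple_graph :: "'v graph \<Rightarrow> bool" where
  "finite_simple_graph G \<longleftrightarrow>
     finite (verts G) \<and> (\<forall>e\<in>edges G. e \<subseteq> verts G \<and> card e = 2)"

definition path_graph :: "nat \<Rightarrow> nat graph" where
  "path_graph n = \<lparr>verts = {0..<n}, edges = {{i, Suc i} | i. Suc i < n}\<rparr>"

definition cartesian_product :: "'a graph \<Rightarrow> 'b graph \<Rightarrow> ('a \<times> 'b) graph" where
  "cartesian_product G H =
     \<lparr>verts = verts G \<times> verts H,
      edges = {{(u, x), (v, x)} | u v x. {u, v} \<in> edges G \<and> x \<in> verts H}
            \<union> {{(u, x), (u, y)} | u x y. u \<in> verts G \<and> {x, y} \<in> edges H}\<rparr>"

definition grid_2 :: "nat \<Rightarrow> (nat \<times> nat) graph" where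
  "grid_2 n = cartesian_product (path_graph n) (path_graph 2)"


text \<open>
  A robber trajectory \<open>r\<close> lists the robber's positions: \<open>r 0\<close> is his starting vertex and
  \<open>r t\<close> is his position at the end of round \<open>t\<close> (rounds are numbered from 1).
  Since cop moves delete nothing, the current graph is determined by \<open>r\<close>.
\<close>

definition may_move :: "'v set set \<Rightarrow> 'v \<Rightarrow> 'v \<Rightarrow> bool" where
  "may_move E u v \<longleftrightarrow> v = u \<or> {u, v} \<in> E"

text \<open>
  The edges present after \<open>t\<close> rounds. A round in which the robber stays put
  contributes a singleton \<open>{r s}\<close>, which is not an edge of a simple graph.
\<close>

definition remaining_edges :: "'v graph \<Rightarrow> (nat \<Rightarrow> 'v) \<Rightarrow> nat \<Rightarrow> 'v set set" where
  "remaining_edges G r t = edges G - {{r s, r (Suc s)} | s. s < t}"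

definition robber_play :: "'v graph \<Rightarrow> (nat \<Rightarrow> 'v) \<Rightarrow> bool" where
  "robber_play G r \<longleftrightarrow>
     r 0 \<in> verts G \<and> (\<forall>t. may_move (remaining_edges G r t) (r t) (r (Suc t)))"

text \<open>
  A cop strategy maps the list of all robber positions seen so far to the list of the cops'
  positions: \<open>\<sigma> []\<close> is the initial placement and \<open>\<sigma> [r 0, \<dots>, r t]\<close> is the placement after the
  cops' move in round \<open>t + 1\<close>. The cops' own earlier moves and the current graph are functions
  of this history, so this is full information.
\<close>

type_synonym 'v cop_strategy = "'v list \<Rightarrow> 'v list"

definition cop_positions :: "'v cop_strategy \<Rightarrow> (nat \<Rightarrow> 'v) \<Rightarrow> nat \<Rightarrow> 'v list" where
  "cop_positions \<sigma> r t = \<sigma> (map r [0..<t])"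

text \<open>
  Plays are continued formally after a capture. This is harmless, as every player may stay put.
\<close>

definition legal_cop_strategy :: "'v graph \<Rightarrow> nat \<Rightarrow> 'v cop_strategy \<Rightarrow> bool" where
  "legal_cop_strategy G k \<sigma> \<longleftrightarrow>
     length (\<sigma> []) = k \<and> set (\<sigma> []) \<subseteq> verts G \<and>
     (\<forall>r. robber_play G r \<longrightarrow>
        (\<forall>t. list_all2 (may_move (remaining_edges G r t))
               (cop_positions \<sigma> r t) (cop_positions \<sigma> r (Suc t))))"

text \<open>
  The robber at \<open>r t\<close> can be caught at the moment he arrives there, or by
  the cops' following move.
\<close>

definition captures :: "'v cop_strategy \<Rightarrow> (nat \<Rightarrow> 'v) \<Rightarrow> bool" where
  "captures \<sigma> r \<longleftrightarrow>
     (\<exists>t. r t \<in> set (cop_positions \<sigma> r t) \<or> r t \<in> set (cop_positions \<sigma> r (Suc t)))"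

definition cops_win :: "'v graph \<Rightarrow> nat \<Rightarrow> bool" where
  "cops_win G k \<longleftrightarrow>
     (\<exists>\<sigma>. legal_cop_strategy G k \<sigma> \<and> (\<forall>r. robber_play G r \<longrightarrow> captures \<sigma> r))"

definition bb_cop_number :: "'v graph \<Rightarrow> nat" where
  "bb_cop_number G = (LEAST k. cops_win G k)"


lemma finite_simple_graph_grid_2: "finite_simple_graph (grid_2 n)"
  by (auto simp: finite_simple_graph_def grid_2_def cartesian_product_def path_graph_def
      card_insert_if doubleton_eq_iff)

text \<open>The minimum defining \<^const>\<open>bb_cop_number\<close> exists for every finite graph.\<close>

lemma cops_win_card_verts:
  assumes "finite (verts G)"
  shows "cops_win G (card (verts G))"
proof -
  obtain vs where vs: "set vs = verts G" "length vs = card (verts G)"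
    using assms by (metis distinct_card finite_distinct_list)
  have "legal_cop_strategy G (card (verts G)) (\<lambda>_. vs)"
    using vs by (auto simp: legal_cop_strategy_def cop_positions_def may_move_def
        intro!: list_all2_refl)
  moreover have "captures (\<lambda>_. vs) r" if "robber_play G r" for r
    using that vs by (auto simp: captures_def cop_positions_def robber_play_def)
  ultimately show ?thesis by (auto simp: cops_win_def)
qed

end

theory Submission
  imports Defs
begin

text \<open>
  Upper bound: with cops in columns 3, 12, 21, \<open>\<dots>\<close> of one row, there are at most 8 columns
  between consecutive cops and at most 3 outside the extreme ones. A robber between two cops
  is beaten by these two, and a robber outside by the nearest cop; since the robber is either caught
  within a few rounds or ends up fleeing along an intact ladder with a cop level with him in the
  other row, a finite certificate suffices.

  Lower bound: by five fixed moves the robber deletes all edges at his final position. A cop can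
  interfere with this only if he starts in a zone consisting of 9 consecutive columns of one row
  and the same 9 columns shifted by one of the other row. Such a zone may begin in any column from
  -5 to \<open>n - 5\<close>, in either row, and \<open>k\<close> cops cannot meet all these zones if
  \<open>n \<ge> 9 k - 1\<close>.
\<close>

section \<open>Forcing a capture in boundedly many rounds\<close>

text \<open>The cops are to move and \<open>E\<close> is the current edge set. A bound on the number
  of rounds replaces strategies, so that wins can be composed by induction. If the robber stays put,
  \<open>{r, r'}\<close> is a singleton, so no edge of a simple graph is lost.\<close>

primrec forced_in :: "nat \<Rightarrow> 'v set set \<Rightarrow> 'v list \<Rightarrow> 'v \<Rightarrow> bool" where
  "forced_in 0 E cs r \<longleftrightarrow> False"
| "forced_in (Suc m) E cs r \<longleftrightarrow>
     (\<exists>cs'. list_all2 (may_move E) cs cs' \<and>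
        (r \<in> set cs' \<or>
         (\<forall>r'. may_move E r r' \<longrightarrow> r' \<in> set cs' \<or> forced_in m (E - {{r, r'}}) cs' r')))"

lemma may_move_refl [simp]: "may_move E v v"
  by (simp add: may_move_def)

lemma list_all2_may_move_refl [simp]: "list_all2 (may_move E) cs cs"
  by (simp add: list_all2_refl)

lemma forced_in_mono: "forced_in m E cs r \<Longrightarrow> m \<le> m' \<Longrightarrow> forced_in m' E cs r"
proof (induction m arbitrary: m' E cs r)
  case (Suc m)
  then obtain l where l: "m' = Suc l" "m \<le> l"
    by (metis Suc_le_D Suc_le_mono)
  show ?case
    using Suc.prems(1) Suc.IH[OF _ l(2)] unfolding l(1) forced_in.simps by meson
qed simp

text \<open>The additional cops never move. Hence a win by one or two neighbouring cops is a win for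
  the whole team.\<close>

lemma forced_in_append: "forced_in m E cs r \<Longrightarrow> forced_in m E (xs @ cs @ ys) r"
proof (induction m arbitrary: E cs r)
  case (Suc m)
  then obtain cs' where cs': "list_all2 (may_move E) cs cs'"
    "r \<in> set cs' \<or> (\<forall>r'. may_move E r r' \<longrightarrow> r' \<in> set cs' \<or> forced_in m (E - {{r, r'}}) cs' r')"
    by auto
  have "list_all2 (may_move E) (xs @ cs @ ys) (xs @ cs' @ ys)"
    using cs'(1) by (intro list_all2_appendI) simp_all
  then show ?case
    using cs'(2) Suc.IH unfolding forced_in.simps by (intro exI[of _ "xs @ cs' @ ys"]) auto
qed simp

lemma forced_inI:
  assumes "list_all2 (may_move E) cs cs'"
    and "\<And>r'. may_move E r r' \<Longrightarrow> r' \<notin> set cs' \<Longrightarrow> forced_in m (E - {{r, r'}}) cs' r'"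
  shows "forced_in (Suc m) E cs r"
  using assms by auto

lemma forced_in_capture:
  assumes "c \<in> set cs" "may_move E c r"
  shows "forced_in (Suc m) E cs r"
proof -
  obtain xs ys where cs: "cs = xs @ [c] @ ys"
    using split_list[OF assms(1)] by auto
  have "forced_in (Suc m) E [c] r"
    unfolding forced_in.simps using assms(2) by (intro exI[of _ "[r]"]) simp
  then show ?thesis
    unfolding cs by (rule forced_in_append)
qed

text \<open>The histories in \<open>trail\<close> and \<open>follow\<close> are listed with the latest position first.\<close>

fun trail :: "'v list \<Rightarrow> 'v set set" where
  "trail (a # b # h) = insert {b, a} (trail (b # h))"
| "trail _ = {}"

definition forcing_move :: "nat \<Rightarrow> 'v set set \<Rightarrow> 'v list \<Rightarrow> 'v \<Rightarrow> 'v list \<Rightarrow> bool" where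
  "forcing_move m E cs r cs' \<longleftrightarrow> list_all2 (may_move E) cs cs' \<and>
     (r \<in> set cs' \<or> (\<forall>r'. may_move E r r' \<longrightarrow> r' \<in> set cs' \<or> forced_in m (E - {{r, r'}}) cs' r'))"

text \<open>The default \<open>cs\<close> makes the reply legal even in positions without a forcing
  move.\<close>

definition reply :: "nat \<Rightarrow> 'v set set \<Rightarrow> 'v list \<Rightarrow> 'v \<Rightarrow> 'v list" where
  "reply m E cs r = (if \<exists>cs'. forcing_move m E cs r cs' then SOME cs'. forcing_move m E cs r cs' else cs)"

primrec follow :: "'v graph \<Rightarrow> 'v list \<Rightarrow> nat \<Rightarrow> 'v list \<Rightarrow> 'v list" where
  "follow G cs0 N [] = cs0"
| "follow G cs0 N (r # h) = reply (N - Suc (length h)) (edges G - trail (r # h)) (follow G cs0 N h) r"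

lemma legal_reply: "list_all2 (may_move E) cs (reply m E cs r)"
proof (cases "\<exists>cs'. forcing_move m E cs r cs'")
  case True
  then have "forcing_move m E cs r (reply m E cs r)"
    by (simp add: reply_def someI_ex)
  then show ?thesis
    by (simp add: forcing_move_def)
qed (simp add: reply_def)

lemma forcing_reply:
  assumes "forced_in (Suc m) E cs r"
  shows "forcing_move m E cs r (reply m E cs r)"
proof -
  have "\<exists>cs'. forcing_move m E cs r cs'"
    using assms by (auto simp: forcing_move_def)
  then show ?thesis
    by (simp add: reply_def someI_ex)
qed

lemma trail_rev: "trail (rev (map r [0..<Suc t])) = {{r s, r (Suc s)} | s. s < t}"
proof (induction t)
  case (Suc t)
  then show ?case by (auto simp: less_Suc_eq)
qed simp

text \<open>As the graph is finite, one bound \<open>N\<close> serves all starting vertices. Each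
  reply keeps the position forced in one round fewer, so an uncaptured robber would reach a position
  forced in 0 rounds, which does not exist.\<close>

lemma cops_win_if_forced:
  assumes fin: "finite (verts G)" and len: "length cs0 = k" and sub: "set cs0 \<subseteq> verts G"
    and forced: "\<And>r. r \<in> verts G \<Longrightarrow> r \<notin> set cs0 \<Longrightarrow> \<exists>m. forced_in m (edges G) cs0 r"
  shows "cops_win G k"
proof -
  have "\<exists>m. \<forall>r\<in>verts G. r \<in> set cs0 \<or> forced_in (m r) (edges G) cs0 r"
    using forced by (metis (no_types, lifting))
  then obtain m where m: "\<And>r. r \<in> verts G \<Longrightarrow> r \<in> set cs0 \<or> forced_in (m r) (edges G) cs0 r"
    by blast
  define N where "N = Max (insert 0 (m ` verts G))"
  have N: "r \<in> set cs0 \<or> forced_in N (edges G) cs0 r" if "r \<in> verts G" for r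
    using m[OF that] forced_in_mono[of "m r" "edges G" cs0 r N] fin that by (auto simp: N_def)
  define \<sigma> where "\<sigma> h = follow G cs0 N (rev h)" for h
  have pos0: "cop_positions \<sigma> r 0 = cs0" for r
    by (simp add: cop_positions_def \<sigma>_def)
  have posS: "cop_positions \<sigma> r (Suc t) =
      reply (N - Suc t) (remaining_edges G r t) (cop_positions \<sigma> r t) (r t)" for r t
  proof -
    have "rev (map r [0..<Suc t]) = r t # rev (map r [0..<t])" by simp
    then show ?thesis
      using trail_rev[of r t] by (simp add: cop_positions_def \<sigma>_def remaining_edges_def)
  qed
  have "legal_cop_strategy G k \<sigma>"
    unfolding legal_cop_strategy_def posS
    using len sub by (auto simp: \<sigma>_def legal_reply)
  moreover have "captures \<sigma> r" if play: "robber_play G r" for r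
  proof (rule ccontr)
    assume "\<not> captures \<sigma> r"
    then have free: "r t \<notin> set (cop_positions \<sigma> r t)" "r t \<notin> set (cop_positions \<sigma> r (Suc t))" for t
      by (auto simp: captures_def)
    have "forced_in (N - t) (remaining_edges G r t) (cop_positions \<sigma> r t) (r t)" for t
    proof (induction t)
      case 0
      then show ?case
        using N[of "r 0"] free(1)[of 0] play by (auto simp: pos0 remaining_edges_def robber_play_def)
    next
      case (Suc t)
      then have "N - t \<noteq> 0" by (metis forced_in.simps(1))
      then have "N - t = Suc (N - Suc t)" by simp
      then have "forcing_move (N - Suc t) (remaining_edges G r t) (cop_positions \<sigma> r t) (r t)
          (cop_positions \<sigma> r (Suc t))"
        unfolding posS using Suc.IH by (intro forcing_reply) simp
      moreover have "may_move (remaining_edges G r t) (r t) (r (Suc t))"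
        using play by (simp add: robber_play_def)
      ultimately have "forced_in (N - Suc t) (remaining_edges G r t - {{r t, r (Suc t)}})
          (cop_positions \<sigma> r (Suc t)) (r (Suc t))"
        using free(1)[of "Suc t"] free(2)[of t] by (auto simp: forcing_move_def)
      moreover have "remaining_edges G r t - {{r t, r (Suc t)}} = remaining_edges G r (Suc t)"
        by (auto simp: remaining_edges_def less_Suc_eq)
      ultimately show ?case by simp
    qed
    from this[of N] show False by simp
  qed
  ultimately show ?thesis unfolding cops_win_def by blast
qed

text \<open>The robber commits to a whole trajectory once the initial placement is known, so
  watching him gains nothing. The edge sets are then fixed, and each cop can be treated alone, as a
  walk \<open>p\<close> in these shrinking graphs.\<close>

lemma not_cops_win_if_evades:
  assumes "\<And>cs. length cs = k \<Longrightarrow> set cs \<subseteq> verts G \<Longrightarrow> \<exists>r. robber_play G r \<and>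
    (\<forall>c\<in>set cs. \<forall>p. p 0 = c \<longrightarrow> (\<forall>t. may_move (remaining_edges G r t) (p t) (p (Suc t))) \<longrightarrow>
       (\<forall>t. r t \<noteq> p t \<and> r t \<noteq> p (Suc t)))"
  shows "\<not> cops_win G k"
proof
  assume "cops_win G k"
  then obtain \<sigma> where legal: "legal_cop_strategy G k \<sigma>"
    and win: "\<And>r. robber_play G r \<Longrightarrow> captures \<sigma> r"
    by (auto simp: cops_win_def)
  obtain r where r: "robber_play G r"
    and evades: "\<And>c p t. c \<in> set (\<sigma> []) \<Longrightarrow> p 0 = c \<Longrightarrow>
      (\<And>t. may_move (remaining_edges G r t) (p t) (p (Suc t))) \<Longrightarrow> r t \<noteq> p t \<and> r t \<noteq> p (Suc t)"
    using assms[of "\<sigma> []"] legal unfolding legal_cop_strategy_def by meson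
  define p where "p i t = cop_positions \<sigma> r t ! i" for i t
  have step: "list_all2 (may_move (remaining_edges G r t))
      (cop_positions \<sigma> r t) (cop_positions \<sigma> r (Suc t))" for t
    using legal r by (simp add: legal_cop_strategy_def)
  have len: "length (cop_positions \<sigma> r t) = k" for t
  proof (induction t)
    case 0
    then show ?case using legal by (simp add: cop_positions_def legal_cop_strategy_def)
  next
    case (Suc t)
    then show ?case using list_all2_lengthD[OF step[of t]] by simp
  qed
  have "r t \<noteq> p i t \<and> r t \<noteq> p i (Suc t)" if "i < k" for i t
  proof (rule evades)
    show "p i 0 \<in> set (\<sigma> [])"
      using that len[of 0] by (simp add: p_def cop_positions_def)
    show "may_move (remaining_edges G r t) (p i t) (p i (Suc t))" for t
      using list_all2_nthD[OF step] that len by (simp add: p_def)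
  qed simp
  then have "r t \<notin> set (cop_positions \<sigma> r t) \<and> r t \<notin> set (cop_positions \<sigma> r (Suc t))" for t
    by (metis in_set_conv_nth len p_def)
  then show False
    using win[OF r] by (auto simp: captures_def)
qed

section \<open>The robber's escape\<close>

lemma verts_grid [simp]: "verts (grid_2 n) = {0..<n} \<times> {0..<2}"
  by (simp add: grid_2_def cartesian_product_def path_graph_def)

lemma edge_path_graph: "{i, j} \<in> edges (path_graph n) \<longleftrightarrow> (j = Suc i \<or> i = Suc j) \<and> i < n \<and> j < n"
  by (auto simp: path_graph_def doubleton_eq_iff)

lemma edge_cartesian_product:
  "{(a, b), (c, d)} \<in> edges (cartesian_product G H) \<longleftrightarrow>
     b = d \<and> b \<in> verts H \<and> {a, c} \<in> edges G \<or> a = c \<and> a \<in> verts G \<and> {b, d} \<in> edges H"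
proof
  assume "b = d \<and> b \<in> verts H \<and> {a, c} \<in> edges G \<or> a = c \<and> a \<in> verts G \<and> {b, d} \<in> edges H"
  then show "{(a, b), (c, d)} \<in> edges (cartesian_product G H)"
    unfolding cartesian_product_def by auto
qed (auto simp: cartesian_product_def doubleton_eq_iff insert_commute)

lemma edge_grid:
  "{(a, b), (c, d)} \<in> edges (grid_2 n) \<longleftrightarrow>
     a < n \<and> c < n \<and> b < 2 \<and> d < 2 \<and> (b = d \<and> (c = Suc a \<or> a = Suc c) \<or> a = c \<and> b \<noteq> d)"
  unfolding grid_2_def edge_cartesian_product edge_path_graph
  by (auto simp: path_graph_def)

text \<open>
  The escape is described on the infinite ladder, with columns relative to the robber's start, the
  robber first moving towards smaller columns, and with \<^const>\<open>True\<close> for the row of his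
  start. After five moves all edges at his position are gone. A cop who is outside
  \<open>danger t\<close> after round \<open>t\<close> cannot interfere.
\<close>

definition escape :: "nat \<Rightarrow> int \<times> bool" where
  "escape t = (if t = 0 then (0, True) else if t = 1 then (-1, True) else if t = 2 then (-1, False)
     else if t = 3 then (-2, False) else if t = 4 then (-2, True) else (-1, True))"

definition danger :: "nat \<Rightarrow> (int \<times> bool) set" where
  "danger t =
     (if t = 0 then {-7..1} \<times> {True} \<union> {-6..2} \<times> {False}
      else if t = 1 then {-6..0} \<times> {True} \<union> {-5..1} \<times> {False}
      else if t = 2 then {-5..-1} \<times> {True} \<union> {-4..0} \<times> {False}
      else if t = 3 then {-4..-1} \<times> {True} \<union> {-3..-2} \<times> {False}
      else if t = 4 then {-3..-1} \<times> {True}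
      else {-1} \<times> {True})"

definition ladder_adjacent :: "int \<times> bool \<Rightarrow> int \<times> bool \<Rightarrow> bool" where
  "ladder_adjacent p q \<longleftrightarrow>
     snd p = snd q \<and> \<bar>fst p - fst q\<bar> = 1 \<or> fst p = fst q \<and> snd p \<noteq> snd q"

lemma escape_in_danger: "escape t \<in> danger t"
  by (simp add: escape_def danger_def)

text \<open>Read backwards: \<open>danger t\<close> contains every vertex from which one cop move
  along the edges left reaches \<open>danger (Suc t)\<close> or the robber at
  \<open>escape t\<close>. This is a finite check for each of the first five rounds.\<close>

lemma outside_danger_step:
  assumes "p \<notin> danger t"
    and "q = p \<or> ladder_adjacent p q \<and> (\<forall>s<t. {p, q} \<noteq> {escape s, escape (Suc s)})"
  shows "q \<notin> danger (Suc t) \<and> q \<noteq> escape t"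
proof -
  obtain a b c d where pq: "p = (a, b)" "q = (c, d)" by fastforce
  have ne: "{p, q} \<noteq> {escape s, escape (Suc s)}" if "s < t" "q \<noteq> p" for s
    using assms(2) that by blast
  have ladder: "q = p \<or> ladder_adjacent p q"
    using assms(2) by blast
  consider "t = 0" | "t = 1" | "t = 2" | "t = 3" | "t = 4" | "t \<ge> 5" by linarith
  then show ?thesis
  proof cases
    case 1
    with assms(1) ladder show ?thesis
      unfolding pq by (cases b; cases d)
        (auto simp: danger_def escape_def ladder_adjacent_def doubleton_eq_iff)
  next
    case 2
    with assms(1) ladder ne[of 0] show ?thesis
      unfolding pq by (cases b; cases d)
        (auto simp: danger_def escape_def ladder_adjacent_def doubleton_eq_iff)
  next
    case 3
    with assms(1) ladder ne[of 0] ne[of 1] show ?thesis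
      unfolding pq by (cases b; cases d)
        (auto simp: danger_def escape_def ladder_adjacent_def doubleton_eq_iff)
  next
    case 4
    with assms(1) ladder ne[of 0] ne[of 1] ne[of 2] show ?thesis
      unfolding pq by (cases b; cases d)
        (auto simp: danger_def escape_def ladder_adjacent_def doubleton_eq_iff)
  next
    case 5
    with assms(1) ladder ne[of 0] ne[of 1] ne[of 2] ne[of 3] show ?thesis
      unfolding pq by (cases b; cases d)
        (auto simp: danger_def escape_def ladder_adjacent_def doubleton_eq_iff)
  next
    \<comment> \<open>From now on \<open>(-1, True)\<close> is isolated: its three edges were
      deleted by the first, second and fifth move.\<close>
    case 6
    with assms(1) ladder ne[of 0] ne[of 1] ne[of 4] show ?thesis
      unfolding pq by (cases b; cases d)
        (auto simp: danger_def escape_def ladder_adjacent_def doubleton_eq_iff)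
  qed
qed

lemma escape_evades_on_ladder:
  assumes "q 0 \<notin> danger 0"
    and "\<And>t. q (Suc t) = q t \<or> ladder_adjacent (q t) (q (Suc t)) \<and>
           (\<forall>s<t. {q t, q (Suc t)} \<noteq> {escape s, escape (Suc s)})"
  shows "escape t \<noteq> q t \<and> escape t \<noteq> q (Suc t)"
proof -
  have "q t \<notin> danger t"
    by (induction t) (use assms outside_danger_step in blast)+
  then show ?thesis
    using outside_danger_step[OF _ assms(2)] escape_in_danger by metis
qed

text \<open>Relative coordinates carry the grid into the ladder: \<open>s = -1\<close> reflects it,
  and \<open>\<rho>\<close> is the row called \<open>True\<close>. The robber only visits the
  columns \<open>y\<close>, \<open>y - s\<close> and \<open>y - 2 * s\<close>, which the bounds keep
  inside the grid.\<close>

lemma escape_evades: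
  fixes s :: int and y :: nat
  assumes s: "s = 1 \<or> s = -1" and y: "0 \<le> int y - 2 * s" "int y - 2 * s < int n" "y < n"
    and \<rho>: "\<rho> < 2"
    and cs: "set cs \<subseteq> verts (grid_2 n)"
    and safe: "\<And>c. c \<in> set cs \<Longrightarrow> (s * (int (fst c) - int y), snd c = \<rho>) \<notin> danger 0"
  shows "\<exists>r. robber_play (grid_2 n) r \<and>
    (\<forall>c\<in>set cs. \<forall>p. p 0 = c \<longrightarrow>
       (\<forall>t. may_move (remaining_edges (grid_2 n) r t) (p t) (p (Suc t))) \<longrightarrow>
       (\<forall>t. r t \<noteq> p t \<and> r t \<noteq> p (Suc t)))"
proof -
  define r where "r t = (nat (int y + s * fst (escape t)), if snd (escape t) then \<rho> else 1 - \<rho>)" for t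
  define \<psi> where "\<psi> v = (s * (int (fst v) - int y), snd v = \<rho>)" for v :: "nat \<times> nat"
  have inj: "\<psi> v = \<psi> w \<longleftrightarrow> v = w" if "snd v < 2" "snd w < 2" for v w
    using that s \<rho> by (cases v; cases w) (auto simp: \<psi>_def)
  have r_row: "snd (r t) < 2" for t
    using \<rho> by (auto simp: r_def)
  have flip: "1 - \<rho> \<noteq> \<rho>"
    using \<rho> by arith
  have \<psi>_r: "\<psi> (r t) = escape t" for t
    using s y \<rho> flip by (auto simp: \<psi>_def r_def escape_def)
  have r_edge: "{r t, r (Suc t)} \<in> edges (grid_2 n)" if "t < 5" for t
  proof -
    have "t = 0 \<or> t = 1 \<or> t = 2 \<or> t = 3 \<or> t = 4" using that by linarith
    then show ?thesis
      using s y \<rho> by (cases "\<rho> = 0"; elim disjE) (auto simp: r_def escape_def edge_grid)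
  qed
  have r_stays: "r (Suc t) = r t" if "t \<ge> 5" for t
    using that by (simp add: r_def escape_def)
  \<comment> \<open>The five edges of the escape are pairwise distinct, so each is still present
    when the robber needs it.\<close>
  have r_new: "{r t, r (Suc t)} \<noteq> {r u, r (Suc u)}" if "u < t" "t < 5" for t u
  proof -
    have "{escape t, escape (Suc t)} \<noteq> {escape u, escape (Suc u)}"
    proof -
      have "t = 1 \<or> t = 2 \<or> t = 3 \<or> t = 4" "u = 0 \<or> u = 1 \<or> u = 2 \<or> u = 3"
        using that by linarith+
      then show ?thesis
        using that by (elim disjE) (simp_all add: escape_def doubleton_eq_iff)
    qed
    then have "\<psi> ` {r t, r (Suc t)} \<noteq> \<psi> ` {r u, r (Suc u)}" by (simp add: \<psi>_r)
    then show ?thesis by metis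
  qed
  have play: "robber_play (grid_2 n) r"
    unfolding robber_play_def
  proof (intro conjI allI)
    show "r 0 \<in> verts (grid_2 n)"
      using y \<rho> by (simp add: r_def escape_def)
    show "may_move (remaining_edges (grid_2 n) r t) (r t) (r (Suc t))" for t
      using r_edge[of t] r_stays[of t] r_new[of _ t]
      by (cases "t < 5") (auto simp: may_move_def remaining_edges_def)
  qed
  have "r t \<noteq> p t \<and> r t \<noteq> p (Suc t)"
    if c: "c \<in> set cs" "p 0 = c"
      and p: "\<And>t. may_move (remaining_edges (grid_2 n) r t) (p t) (p (Suc t))" for c p t
  proof -
    have step: "p (Suc t) = p t \<or> {p t, p (Suc t)} \<in> edges (grid_2 n) \<and>
        (\<forall>u<t. {p t, p (Suc t)} \<noteq> {r u, r (Suc u)})" for t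
      using p[of t] unfolding may_move_def remaining_edges_def by blast
    have p_row: "snd (p t) < 2" for t
    proof (induction t)
      case 0
      then show ?case using c cs by auto
    next
      case (Suc t)
      then show ?case
        using step[of t] by (cases "p t"; cases "p (Suc t)") (auto simp: edge_grid)
    qed
    have "\<psi> (p (Suc t)) = \<psi> (p t) \<or> ladder_adjacent (\<psi> (p t)) (\<psi> (p (Suc t))) \<and>
        (\<forall>u<t. {\<psi> (p t), \<psi> (p (Suc t))} \<noteq> {escape u, escape (Suc u)})" for t
    proof (cases "p (Suc t) = p t")
      case False
      then have e: "{p t, p (Suc t)} \<in> edges (grid_2 n)"
        and ne: "\<And>u. u < t \<Longrightarrow> {p t, p (Suc t)} \<noteq> {r u, r (Suc u)}"
        using step[of t] by auto
      have "ladder_adjacent (\<psi> (p t)) (\<psi> (p (Suc t)))"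
        using e s \<rho> by (cases "p t"; cases "p (Suc t)")
          (auto simp: edge_grid ladder_adjacent_def \<psi>_def)
      moreover have "{\<psi> (p t), \<psi> (p (Suc t))} \<noteq> {escape u, escape (Suc u)}" if "u < t" for u
        using ne[OF that] unfolding \<psi>_r[symmetric] doubleton_eq_iff by (simp add: inj p_row r_row)
      ultimately show ?thesis by blast
    qed simp
    then have "escape t \<noteq> \<psi> (p t) \<and> escape t \<noteq> \<psi> (p (Suc t))"
      using safe[OF c(1)] c(2) by (intro escape_evades_on_ladder[of "\<psi> \<circ> p" t, simplified])
        (simp_all add: \<psi>_def)
    then show ?thesis using \<psi>_r[of t] by metis
  qed
  then show ?thesis using play by blast
qed

text \<open>Two escapes share this zone: one starts at column \<open>a + 7\<close> in row
  \<open>\<rho>\<close> and runs left, the other starts at column \<open>a + 2\<close> in the other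
  row and runs right. The first fits if \<open>a \<le> n - 8\<close>, otherwise the second
  does.\<close>

lemma evades_if_zone_free:
  fixes a :: int
  assumes n: "8 \<le> n" and a: "-5 \<le> a" "a \<le> int n - 5" and \<rho>: "\<rho> < 2"
    and cs: "set cs \<subseteq> verts (grid_2 n)"
    and free: "\<And>x \<tau>. (x, \<tau>) \<in> set cs \<Longrightarrow>
      \<not> (if \<tau> = \<rho> then a \<le> int x \<and> int x \<le> a + 8 else a + 1 \<le> int x \<and> int x \<le> a + 9)"
  shows "\<exists>r. robber_play (grid_2 n) r \<and>
    (\<forall>c\<in>set cs. \<forall>p. p 0 = c \<longrightarrow>
       (\<forall>t. may_move (remaining_edges (grid_2 n) r t) (p t) (p (Suc t))) \<longrightarrow>
       (\<forall>t. r t \<noteq> p t \<and> r t \<noteq> p (Suc t)))"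
proof (cases "a \<le> int n - 8")
  case True
  show ?thesis
  \<comment> \<open>In the robber's row \<open>danger 0\<close> begins at -7, which becomes column
    \<open>a\<close>. He gets as far left as column \<open>a + 5\<close>, which is
    nonnegative.\<close>
  proof (rule escape_evades[of 1 "nat (a + 7)" n \<rho>])
    show "(1 * (int (fst c) - int (nat (a + 7))), snd c = \<rho>) \<notin> danger 0" if "c \<in> set cs" for c
      using free[of "fst c" "snd c"] that a by (auto simp: danger_def split: if_splits)
  qed (use True n a \<rho> cs in auto)
next
  case False
  have *: "snd c = 1 - \<rho> \<longleftrightarrow> snd c \<noteq> \<rho>" if "c \<in> set cs" for c
    using subsetD[OF cs that] \<rho> by (cases c; cases "\<rho> = 0") auto
  show ?thesis
  \<comment> \<open>The reflected \<open>danger 0\<close> covers columns \<open>a + 1\<close> to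
    \<open>a + 9\<close> in the robber's row and \<open>a\<close> to \<open>a + 8\<close> in the
    other. He gets as far right as column \<open>a + 4\<close>, at most
    \<open>n - 1\<close>.\<close>
  proof (rule escape_evades[of "-1" "nat (a + 2)" n "1 - \<rho>"])
    show "(-1 * (int (fst c) - int (nat (a + 2))), snd c = 1 - \<rho>) \<notin> danger 0" if "c \<in> set cs" for c
      using free[of "fst c" "snd c"] that a False n *[OF that]
      by (auto simp: danger_def split: if_splits)
  qed (use False n a \<rho> cs in auto)
qed

section \<open>Counting cops against the zones\<close>

lemma length_filter_less:
  assumes "v \<in> set xs" "Q v" "\<not> P v" "\<And>x. P x \<Longrightarrow> Q x"
  shows "length (filter P xs) < length (filter Q xs)"
proof -
  have "filter P xs = filter P (filter Q xs)"
    using assms(4) by (auto intro: filter_cong)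
  then show ?thesis
    using length_filter_less[of v "filter Q xs" P] assms by simp
qed

lemma length_filter_less2:
  assumes "v \<in> set xs" "w \<in> set xs" "v \<noteq> w" "Q v" "Q w" "\<not> P v" "\<not> P w" "\<And>x. P x \<Longrightarrow> Q x"
  shows "length (filter P xs) + 2 \<le> length (filter Q xs)"
proof -
  have "length (filter P xs) < length (filter (\<lambda>x. P x \<or> x = v) xs)"
    using assms by (intro length_filter_less[of v]) auto
  moreover have "length (filter (\<lambda>x. P x \<or> x = v) xs) < length (filter Q xs)"
    using assms by (intro length_filter_less[of w]) auto
  ultimately show ?thesis by linarith
qed

text \<open>Suppose every zone is met. For each \<open>j < k\<close> the two zones starting at
  \<open>9 * j - 5\<close> cover a block of nine columns and overhang it by one column. Meeting both
  takes at least one cop in the block or two in the overhang. From left to right this ties down all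
  \<open>k\<close> cops, and the zones at \<open>n - 5\<close> give the contradiction.\<close>

lemma zone_free_exists:
  assumes k: "k \<ge> 1" "9 * k \<le> n + 1" and len: "length cs = k"
    and cs: "set cs \<subseteq> verts (grid_2 n)"
  obtains a :: int and \<rho> :: nat where "-5 \<le> a" "a \<le> int n - 5" "\<rho> < 2"
    "\<And>x \<tau>. (x, \<tau>) \<in> set cs \<Longrightarrow>
      \<not> (if \<tau> = \<rho> then a \<le> int x \<and> int x \<le> a + 8 else a + 1 \<le> int x \<and> int x \<le> a + 9)"
proof (rule ccontr)
  assume contra: "\<not> thesis"
  note found = that
  have hit: "\<exists>x \<tau>. (x, \<tau>) \<in> set cs \<and>
      (if \<tau> = \<rho> then a \<le> int x \<and> int x \<le> a + 8 else a + 1 \<le> int x \<and> int x \<le> a + 9)"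
    if "-5 \<le> a" "a \<le> int n - 5" "\<rho> < 2" for a :: int and \<rho> :: nat
    using found[OF that] contra by blast
  define cnt where "cnt c = length (filter (\<lambda>v. int (fst v) \<le> c) cs)" for c :: int
  have cnt_mono: "cnt c \<le> cnt d" if "c \<le> d" for c d
  proof -
    have "filter (\<lambda>v. int (fst v) \<le> c) cs =
        filter (\<lambda>v. int (fst v) \<le> c) (filter (\<lambda>v. int (fst v) \<le> d) cs)"
      using that by (auto intro: filter_cong)
    then show ?thesis unfolding cnt_def by (metis length_filter_le)
  qed
  have cnt_less: "cnt c < cnt d" if "v \<in> set cs" "int (fst v) \<le> d" "c < int (fst v)" for v c d
    unfolding cnt_def by (rule length_filter_less[of v]) (use that in auto)
  have cnt_less2: "cnt c + 2 \<le> cnt d"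
    if "v \<in> set cs" "w \<in> set cs" "v \<noteq> w" "int (fst v) \<le> d" "c < int (fst v)"
      "int (fst w) \<le> d" "c < int (fst w)" for v w c d
    unfolding cnt_def by (rule length_filter_less2[of v _ w]) (use that in auto)
  have cnt_le: "cnt c \<le> k" for c
    unfolding cnt_def len[symmetric] by (rule length_filter_le)
  \<comment> \<open>The second alternative stands for a surplus cop, who may be in column
    \<open>9 * j - 5\<close>, the first column of the next block.\<close>
  have claim: "j \<le> cnt (9 * int j - 6) \<or> Suc j \<le> cnt (9 * int j - 5)" if "j \<le> k" for j
    using that
  proof (induction j)
    case (Suc j)
    then have a: "-5 \<le> 9 * int j - 5" "9 * int j - 5 \<le> int n - 5" using k(2) by linarith+
    consider "j \<le> cnt (9 * int j - 6)" | "Suc j \<le> cnt (9 * int j - 5)"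
      using Suc by auto
    then show ?case
    proof cases
      case 1
      obtain x0 \<tau>0 where v0: "(x0, \<tau>0) \<in> set cs"
        "if \<tau>0 = 0 then 9 * int j - 5 \<le> int x0 \<and> int x0 \<le> 9 * int j - 5 + 8
         else 9 * int j - 5 + 1 \<le> int x0 \<and> int x0 \<le> 9 * int j - 5 + 9"
        using hit[OF a, of 0] by auto
      obtain x1 \<tau>1 where v1: "(x1, \<tau>1) \<in> set cs"
        "if \<tau>1 = 1 then 9 * int j - 5 \<le> int x1 \<and> int x1 \<le> 9 * int j - 5 + 8
         else 9 * int j - 5 + 1 \<le> int x1 \<and> int x1 \<le> 9 * int j - 5 + 9"
        using hit[OF a, of 1] by auto
      consider "int x0 \<le> 9 * int j + 3" | "int x1 \<le> 9 * int j + 3"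
        | "int x0 > 9 * int j + 3" "int x1 > 9 * int j + 3"
        by linarith
      then show ?thesis
      proof cases
        case 1
        then have "cnt (9 * int j - 6) < cnt (9 * int j + 3)"
          using cnt_less[OF v0(1)] v0(2) by (auto split: if_splits)
        then show ?thesis using \<open>j \<le> cnt (9 * int j - 6)\<close> by (simp add: algebra_simps)
      next
        case 2
        then have "cnt (9 * int j - 6) < cnt (9 * int j + 3)"
          using cnt_less[OF v1(1)] v1(2) by (auto split: if_splits)
        then show ?thesis using \<open>j \<le> cnt (9 * int j - 6)\<close> by (simp add: algebra_simps)
      next
        case 3
        \<comment> \<open>In the overhang a cop meets the zone of a row only from the other row. So
          the two cops stand in different rows and are distinct.\<close>
        then have "\<tau>0 \<noteq> 0" "\<tau>1 \<noteq> 1" "int x0 = 9 * int j + 4" "int x1 = 9 * int j + 4"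
          using v0(2) v1(2) by (auto split: if_splits)
        moreover from this have "\<tau>0 \<noteq> \<tau>1"
          using subsetD[OF cs v0(1)] subsetD[OF cs v1(1)] by auto
        ultimately have "cnt (9 * int j - 6) + 2 \<le> cnt (9 * int j + 4)"
          by (intro cnt_less2[OF v0(1) v1(1)]) auto
        then show ?thesis using \<open>j \<le> cnt (9 * int j - 6)\<close> by (simp add: algebra_simps)
      qed
    next
      \<comment> \<open>The surplus cop already pays for this block.\<close>
      case 2
      then show ?thesis using cnt_mono[of "9 * int j - 5" "9 * int j + 3"]
        by (simp add: algebra_simps)
    qed
  qed simp
  have a: "-5 \<le> int n - 5" "int n - 5 \<le> int n - 5" and n: "9 * int k - 6 \<le> int n - 5"
    using k by linarith+
  \<comment> \<open>The second alternative of \<open>claim\<close> would need \<open>k + 1\<close>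
    cops.\<close>
  have "cnt (9 * int k - 6) = k"
    using claim[of k] cnt_le[of "9 * int k - 5"] cnt_le[of "9 * int k - 6"] by auto
  then have cols: "int x \<le> 9 * int k - 6" if "(x, \<tau>) \<in> set cs" for x \<tau>
    using cnt_less[OF that, of "int x" "9 * int k - 6"] cnt_le[of "int x"] by fastforce
  obtain x0 \<tau>0 where v0: "(x0, \<tau>0) \<in> set cs"
    "if \<tau>0 = 0 then int n - 5 \<le> int x0 \<and> int x0 \<le> int n - 5 + 8
     else int n - 5 + 1 \<le> int x0 \<and> int x0 \<le> int n - 5 + 9"
    using hit[OF a, of 0] by auto
  obtain x1 \<tau>1 where v1: "(x1, \<tau>1) \<in> set cs"
    "if \<tau>1 = 1 then int n - 5 \<le> int x1 \<and> int x1 \<le> int n - 5 + 8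
     else int n - 5 + 1 \<le> int x1 \<and> int x1 \<le> int n - 5 + 9"
    using hit[OF a, of 1] by auto
  \<comment> \<open>The last two zones can only be met in their first column, each from its own row,
    hence by two different cops. At most \<open>k - 2\<close> cops remain for earlier columns,
    against \<open>claim\<close> for \<open>k - 1\<close>.\<close>
  have "\<tau>0 = 0" "int x0 = 9 * int k - 6" "\<tau>1 = 1" "int x1 = 9 * int k - 6"
    using cols[OF v0(1)] cols[OF v1(1)] v0(2) v1(2) n by (auto split: if_splits)
  then have "cnt c + 2 \<le> k" if "c < 9 * int k - 6" for c
    using cnt_less2[OF v0(1) v1(1), of "9 * int k - 6" c] cnt_le[of "9 * int k - 6"] that by auto
  from this[of "9 * int (k - 1) - 6"] this[of "9 * int (k - 1) - 5"] claim[of "k - 1"] k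
  show False by (auto simp: of_nat_diff)
qed

lemma not_cops_win_grid:
  assumes "n \<ge> 1" "9 * k \<le> n + 1"
  shows "\<not> cops_win (grid_2 n) k"
proof (rule not_cops_win_if_evades)
  fix cs
  assume cs: "length cs = k" "set cs \<subseteq> verts (grid_2 n)"
  show "\<exists>r. robber_play (grid_2 n) r \<and>
    (\<forall>c\<in>set cs. \<forall>p. p 0 = c \<longrightarrow>
       (\<forall>t. may_move (remaining_edges (grid_2 n) r t) (p t) (p (Suc t))) \<longrightarrow>
       (\<forall>t. r t \<noteq> p t \<and> r t \<noteq> p (Suc t)))"
  proof (cases "k = 0")
    case True
    then show ?thesis
      using assms(1) cs(1) by (intro exI[of _ "\<lambda>_. (0, 0)"]) (simp add: robber_play_def)
  next
    case False
    then have k: "k \<ge> 1" by simp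
    obtain a :: int and \<rho> :: nat where "-5 \<le> a" "a \<le> int n - 5" "\<rho> < 2"
      "\<And>x \<tau>. (x, \<tau>) \<in> set cs \<Longrightarrow>
        \<not> (if \<tau> = \<rho> then a \<le> int x \<and> int x \<le> a + 8 else a + 1 \<le> int x \<and> int x \<le> a + 9)"
      using zone_free_exists[OF k assms(2) cs] by blast
    then show ?thesis
      using cs k assms(2) by (intro evades_if_zone_free[of n a \<rho> cs]) auto
  qed
qed

section \<open>Chasing the robber along the ladder\<close>

text \<open>
  The robber runs along \<open>u\<close> and the cop keeps level with him on \<open>w\<close>: turning back is
  impossible for the robber, as he has deleted the edge behind him.
\<close>

lemma chase_step:
  fixes u w :: "nat \<Rightarrow> 'v"
  assumes rung: "\<And>j. j \<le> L \<Longrightarrow> {w j, u j} \<in> E"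
    and rail: "\<And>j. j < L \<Longrightarrow> {w j, w (Suc j)} \<in> E"
    and ahead: "\<And>j v. j \<le> L \<Longrightarrow> {u j, v} \<in> E \<Longrightarrow>
      v = w j \<or> j < L \<and> v = u (Suc j) \<or> 0 < j \<and> v = u (j - 1)"
    and distinct: "\<And>j l. w j \<noteq> u l"
    and i: "i \<le> L" and v: "may_move (E - {{u j, u (Suc j)} | j. j < i}) (u i) v"
  shows "v = w i \<or> forced_in (Suc (L - i)) (E - {{u j, u (Suc j)} | j. j < i} - {{u i, v}}) [w i] v"
  using i v
\<comment> \<open>The induction is on the number of steps left ahead. When none is left, the robber
  can only stay or step onto the cop.\<close>
proof (induction "L - i" arbitrary: i v)
  have stay: "forced_in (Suc m) (E - {{u j, u (Suc j)} | j. j < i} - {{u i, u i}}) [w i] (u i)"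
    if "i \<le> L" for i m
    using rung[OF that] distinct by (intro forced_in_capture) (auto simp: may_move_def doubleton_eq_iff)
  have options: "v = u i \<or> v = w i \<or> i < L \<and> v = u (Suc i)"
    if "i \<le> L" "may_move (E - {{u j, u (Suc j)} | j. j < i}) (u i) v" for i v
  proof (cases "0 < i \<and> v = u (i - 1)")
    case True
    then have "{u i, v} = {u (i - 1), u (Suc (i - 1))}" by auto
    then have "{u i, v} \<in> {{u j, u (Suc j)} | j. j < i}" using True by auto
    then show ?thesis using that(2) by (simp add: may_move_def)
  next
    case False
    then show ?thesis using that ahead[OF that(1), of v] unfolding may_move_def by blast
  qed
  {
    case 0
    then have "v = u i \<or> v = w i" using options[of i v] by auto
    then show ?case using stay[of i "L - i"] 0 by (auto simp del: forced_in.simps)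
  next
    case (Suc d)
    consider "v = u i" | "v = w i" | "i < L" "v = u (Suc i)"
      using options[of i v] Suc.prems by blast
    then show ?case
    proof cases
      case 1
      then show ?thesis using stay[of i "L - i"] Suc.prems by (simp del: forced_in.simps)
    next
      case 3
      let ?E = "E - {{u j, u (Suc j)} | j. j < Suc i}"
      have E: "E - {{u j, u (Suc j)} | j. j < i} - {{u i, v}} = ?E"
        using 3(2) by (auto simp: less_Suc_eq)
      have "may_move ?E (w i) (w (Suc i))"
        using rail[OF 3(1)] distinct by (auto simp: may_move_def doubleton_eq_iff)
      moreover have "v' = w (Suc i) \<or> forced_in (Suc (L - Suc i)) (?E - {{u (Suc i), v'}}) [w (Suc i)] v'"
        if "may_move ?E (u (Suc i)) v'" for v'
        using Suc.hyps(1)[of "Suc i" v'] Suc.hyps(2) 3(1) that by (simp del: forced_in.simps)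
      ultimately have "forced_in (Suc (Suc (L - Suc i))) ?E [w i] (u (Suc i))"
        by (intro forced_inI[where cs' = "[w (Suc i)]" and m = "Suc (L - Suc i)"])
          (auto simp del: forced_in.simps)
      then show ?thesis unfolding E using 3 by (simp add: Suc_diff_Suc del: forced_in.simps)
    qed simp
  }
qed

text \<open>\<open>up\<close> is the direction of flight. Each deleted edge has an end strictly
  behind the robber, so the ladder ahead and the rung at his column are intact, while
  \<open>behind\<close> bars his way back. Once a cop is level in the other row,
  \<open>chase_step\<close> applies.\<close>

lemma forced_in_chase:
  fixes R :: "(nat \<times> nat) set set"
  assumes r: "x < n" "\<rho> < 2"
    and R: "\<And>e. e \<in> R \<Longrightarrow> \<exists>v\<in>e. if up then fst v < x else x < fst v"
    and behind: "\<And>x'. {(x', \<rho>), (x, \<rho>)} \<in> edges (grid_2 n) - R \<Longrightarrow>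
      if up then x < x' else x' < x"
    and c: "c \<in> set cs" "may_move (edges (grid_2 n) - R) c (x, 1 - \<rho>)"
  shows "forced_in (Suc (Suc n)) (edges (grid_2 n) - R) cs (x, \<rho>)"
proof -
  define col where "col j = (if up then x + j else x - j)" for j
  define L where "L = (if up then n - 1 - x else x)"
  let ?E = "edges (grid_2 n) - R"
  have flip: "1 - \<rho> < 2" "1 - \<rho> \<noteq> \<rho>"
    using r(2) by arith+
  have present: "{p, q} \<in> ?E" if "{p, q} \<in> edges (grid_2 n)"
    "if up then x \<le> fst p \<and> x \<le> fst q else fst p \<le> x \<and> fst q \<le> x" for p q
    using that R[of "{p, q}"] by (auto split: if_splits)
  have win: "v = (col 0, 1 - \<rho>) \<or> forced_in (Suc L) (?E - {{(col 0, \<rho>), v}}) [(col 0, 1 - \<rho>)] v"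
    if "may_move ?E (col 0, \<rho>) v" for v
  proof -
    have "v = (col 0, 1 - \<rho>) \<or> forced_in (Suc (L - 0))
        (?E - {{(col j, \<rho>), (col (Suc j), \<rho>)} | j. j < 0} - {{(col 0, \<rho>), v}}) [(col 0, 1 - \<rho>)] v"
    proof (rule chase_step[where u = "\<lambda>j. (col j, \<rho>)" and w = "\<lambda>j. (col j, 1 - \<rho>)" and i = 0])
      show "{(col j, 1 - \<rho>), (col j, \<rho>)} \<in> ?E" if "j \<le> L" for j
        using that r flip by (intro present) (auto simp: edge_grid col_def L_def)
      show "{(col j, 1 - \<rho>), (col (Suc j), 1 - \<rho>)} \<in> ?E" if "j < L" for j
        using that r flip by (intro present) (auto simp: edge_grid col_def L_def split: if_splits)
      show "v = (col j, 1 - \<rho>) \<or> j < L \<and> v = (col (Suc j), \<rho>) \<or> 0 < j \<and> v = (col (j - 1), \<rho>)"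
        if "j \<le> L" and e: "{(col j, \<rho>), v} \<in> ?E" for j v
      proof -
        obtain a b where v: "v = (a, b)" by fastforce
        have g: "{(col j, \<rho>), (a, b)} \<in> edges (grid_2 n)" using e v by simp
        then consider "a = col j" "b = 1 - \<rho>" | "b = \<rho>" "a = Suc (col j) \<or> col j = Suc a" "a < n"
          unfolding edge_grid by fastforce
        then show ?thesis
        proof cases
          case 2
          \<comment> \<open>Only at the start must \<open>behind\<close> exclude a step backwards.
            Later such a step leads to \<open>col (j - 1)\<close>, the third alternative.\<close>
          have "if up then x < a else a < x" if "j = 0"
            using behind[of a] e 2(1) that by (cases up) (simp_all add: v col_def insert_commute)
          then show ?thesis
            using 2 \<open>j \<le> L\<close> r(1) v by (cases j) (auto simp: col_def L_def split: if_splits)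
        qed (use v in simp)
      qed
    qed (use that flip in auto)
    then show ?thesis by simp
  qed
  have "col 0 = x" by (simp add: col_def)
  then have "forced_in (Suc (Suc L)) ?E [c] (x, \<rho>)"
    using c(2) win by (intro forced_inI[where cs' = "[(x, 1 - \<rho>)]" and m = "Suc L"])
      (auto simp del: forced_in.simps)
  moreover have "Suc (Suc L) \<le> Suc (Suc n)"
    using r by (simp add: L_def)
  ultimately have "forced_in (Suc (Suc n)) ?E [c] (x, \<rho>)"
    by (rule forced_in_mono)
  moreover obtain xs ys where "cs = xs @ [c] @ ys"
    using split_list[OF c(1)] by auto
  ultimately show ?thesis by (simp only: forced_in_append)
qed

text \<open>Needed because reflecting a gap exchanges its two cops.\<close>

lemma forced_in_rev: "forced_in m E (rev cs) r \<longleftrightarrow> forced_in m E cs r"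
proof -
  have "forced_in m E cs r \<Longrightarrow> forced_in m E (rev cs) r" for cs
  proof (induction m arbitrary: E cs r)
    case (Suc m)
    then obtain cs' where cs': "list_all2 (may_move E) cs cs'"
      "r \<in> set cs' \<or> (\<forall>r'. may_move E r r' \<longrightarrow> r' \<in> set cs' \<or> forced_in m (E - {{r, r'}}) cs' r')"
      by auto
    then show ?case
      using Suc.IH unfolding forced_in.simps by (intro exI[of _ "rev cs'"]) auto
  qed simp
  from this[of cs] this[of "rev cs"] show ?thesis by auto
qed

section \<open>Certificates for the cops\<close>

text \<open>
  A certificate describes the cops' play in a window of columns \<open>0, \<dots>, D\<close>. The list
  \<open>R\<close> contains the edges that the robber has deleted, and \<open>wall\<close> says that the ladder ends
  at column 0. In \<open>Move cs' a b c d\<close> the cops move to \<open>cs'\<close>, and the four certificates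
  are for the replies of the robber: staying put, moving to the left, to the right, and to the other
  row. At a leaf, the robber can be captured at once or chased to an end of the ladder.
\<close>

datatype cert = Leaf | Move "(nat \<times> nat) list" cert cert cert cert

abbreviation Last :: "(nat \<times> nat) list \<Rightarrow> cert" where
  "Last cs \<equiv> Move cs Leaf Leaf Leaf Leaf"

type_synonym place = "nat \<times> nat"

definition usable :: "nat \<Rightarrow> (place \<times> place) list \<Rightarrow> place \<Rightarrow> place \<Rightarrow> bool" where
  "usable D R p q \<longleftrightarrow> p = q \<or>
     (fst p = fst q \<and> snd p \<noteq> snd q \<or>
      snd p = snd q \<and> (fst q = Suc (fst p) \<or> fst p = Suc (fst q))) \<and>
     fst p \<le> D \<and> fst q \<le> D \<and> snd p < 2 \<and> snd q < 2 \<and> (p, q) \<notin> set R \<and> (q, p) \<notin> set R"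

text \<open>An executable form of the hypotheses of \<open>forced_in_chase\<close>. Here
  \<open>up\<close> is the direction of flight within the window.\<close>

definition no_way_back :: "bool \<Rightarrow> (place \<times> place) list \<Rightarrow> place \<Rightarrow> bool \<Rightarrow> bool" where
  "no_way_back wall R r up \<longleftrightarrow>
     (if up then if fst r = 0 then wall
        else ((fst r - 1, snd r), r) \<in> set R \<or> (r, (fst r - 1, snd r)) \<in> set R
      else ((Suc (fst r), snd r), r) \<in> set R \<or> (r, (Suc (fst r), snd r)) \<in> set R) \<and>
     (\<forall>(p, q)\<in>set R. if up then fst p < fst r \<or> fst q < fst r else fst r < fst p \<or> fst r < fst q)"

text \<open>At a \<open>Move\<close>, the conditions \<open>fst r < D\<close> and
  \<open>wall\<close> at column 0 keep all replies of the robber inside the window.\<close>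

primrec chk :: "nat \<Rightarrow> bool \<Rightarrow> (place \<times> place) list \<Rightarrow> place list \<Rightarrow> place \<Rightarrow> cert \<Rightarrow> bool" where
  "chk D wall R cs r Leaf \<longleftrightarrow>
     (\<exists>c\<in>set cs. usable D R c r) \<or>
     (\<exists>c\<in>set cs. usable D R c (fst r, 1 - snd r)) \<and>
       (no_way_back wall R r True \<or> no_way_back wall R r False)"
| "chk D wall R cs r (Move cs' t0 t1 t2 t3) \<longleftrightarrow>
     list_all2 (usable D R) cs cs' \<and> fst r < D \<and> (fst r = 0 \<longrightarrow> wall) \<and>
     (if r \<in> set cs' then True else chk D wall R cs' r t0) \<and>
     (let q = (fst r - 1, snd r) in
        if fst r \<noteq> 0 \<and> usable D R r q \<and> q \<notin> set cs' then chk D wall ((r, q) # R) cs' q t1 else True) \<and>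
     (let q = (Suc (fst r), snd r) in
        if usable D R r q \<and> q \<notin> set cs' then chk D wall ((r, q) # R) cs' q t2 else True) \<and>
     (let q = (fst r, 1 - snd r) in
        if usable D R r q \<and> q \<notin> set cs' then chk D wall ((r, q) # R) cs' q t3 else True)"

text \<open>A missing key is read as \<open>Leaf\<close>: among the starts checked below, these are
  the ones where the cops capture or chase at once.\<close>

definition lookup :: "('k \<times> cert) list \<Rightarrow> 'k \<Rightarrow> cert" where
  "lookup T k = (case map_of T k of None \<Rightarrow> Leaf | Some t \<Rightarrow> t)"

text \<open>
  The key \<open>(d, x, \<rho>)\<close> stands for a robber starting at \<open>(x, \<rho>)\<close>, with one cop at
  \<open>(d, 0)\<close>, respectively with two cops at \<open>(0, 0)\<close> and \<open>(d, 0)\<close>. The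
  certificates were found by a computer search.
\<close>

definition end_certs :: "((nat \<times> nat \<times> nat) \<times> cert) list" where
  "end_certs = [
    ((2, 0, 0), Move [(1, 0)] Leaf Leaf Leaf (Last [(1, 1)])),
    ((2, 0, 1), Last [(1, 0)]),
    ((2, 1, 1), Last [(1, 0)]),
    ((3, 0, 0), Move [(2, 0)] (Move [(1, 0)] Leaf Leaf Leaf (Last [(1, 1)])) Leaf Leaf (Move
      [(1, 0)] (Last [(1, 1)]) Leaf Leaf Leaf)),
    ((3, 0, 1), Move [(2, 0)] (Last [(1, 0)]) Leaf Leaf (Last [(1, 0)])),
    ((3, 1, 0), Move [(2, 0)] Leaf (Move [(1, 0)] (Last [(1, 1)]) Leaf Leaf (Last [(1, 1)]))
      Leaf (Move [(2, 1)] Leaf (Move [(2, 0)] (Last [(1, 0)]) Leaf Leaf (Last [(1, 0)]))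
      Leaf Leaf)),
    ((3, 1, 1), Move [(2, 0)] (Last [(1, 0)]) (Last [(1, 0)]) Leaf Leaf),
    ((3, 2, 1), Last [(2, 0)])]"

definition gap_certs :: "((nat \<times> nat \<times> nat) \<times> cert) list" where
  "gap_certs = [
    ((2, 1, 1), Last [(1, 0), (2, 0)]),
    ((3, 1, 1), Last [(1, 0), (3, 0)]),
    ((4, 1, 1), Last [(1, 0), (4, 0)]),
    ((4, 2, 0), Move [(1, 0), (3, 0)] Leaf Leaf Leaf (Last [(1, 1), (3, 1)])),
    ((4, 2, 1), Move [(0, 0), (3, 0)] (Last [(0, 0), (2, 0)]) Leaf Leaf Leaf),
    ((5, 1, 1), Last [(1, 0), (5, 0)]),
    ((5, 2, 0), Move [(1, 0), (4, 0)] Leaf Leaf Leaf (Last [(1, 1), (4, 0)])),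
    ((5, 2, 1), Move [(1, 0), (4, 0)] (Last [(2, 0), (4, 0)]) Leaf Leaf Leaf),
    ((6, 1, 1), Last [(1, 0), (6, 0)]),
    ((6, 2, 0), Move [(1, 0), (5, 0)] Leaf Leaf (Move [(2, 0), (4, 0)] Leaf Leaf Leaf (Last
      [(2, 1), (4, 1)])) (Last [(1, 1), (4, 0)])),
    ((6, 2, 1), Move [(1, 0), (6, 0)] (Last [(2, 0), (6, 0)]) Leaf (Last [(2, 0), (5, 0)])
      Leaf),
    ((6, 3, 0), Move [(1, 0), (5, 0)] (Move [(2, 0), (4, 0)] Leaf Leaf Leaf (Last [(2, 1),
      (4, 1)])) Leaf Leaf (Move [(2, 0), (4, 0)] (Last [(2, 1), (4, 1)]) Leaf Leaf Leaf)),
    ((6, 3, 1), Move [(1, 0), (5, 0)] (Move [(1, 0), (4, 0)] (Last [(1, 0), (3, 0)]) Leaf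
      Leaf Leaf) Leaf Leaf (Last [(2, 0), (4, 0)])),
    ((7, 1, 1), Last [(1, 0), (7, 0)]),
    ((7, 2, 0), Move [(1, 0), (6, 0)] Leaf Leaf (Move [(2, 0), (5, 0)] (Last [(2, 1), (4,
      0)]) Leaf Leaf (Last [(2, 1), (5, 0)])) (Move [(1, 1), (5, 0)] Leaf Leaf (Last [(1,
      1), (4, 0)]) Leaf)),
    ((7, 2, 1), Move [(1, 0), (6, 0)] (Last [(2, 0), (6, 0)]) Leaf (Last [(2, 0), (5, 0)])
      Leaf),
    ((7, 3, 0), Move [(1, 0), (6, 0)] (Move [(2, 0), (5, 0)] Leaf Leaf Leaf (Last [(2, 1),
      (5, 0)])) Leaf (Move [(1, 0), (5, 0)] Leaf Leaf Leaf (Last [(2, 0), (5, 1)])) (Move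
      [(2, 0), (5, 0)] (Last [(2, 1), (5, 0)]) Leaf Leaf Leaf)),
    ((7, 3, 1), Move [(1, 0), (6, 0)] (Move [(2, 0), (5, 0)] (Last [(3, 0), (5, 0)]) Leaf
      Leaf Leaf) Leaf (Last [(1, 0), (5, 0)]) (Last [(2, 0), (5, 0)])),
    ((8, 1, 1), Last [(1, 0), (8, 0)]),
    ((8, 2, 0), Move [(1, 0), (7, 0)] Leaf Leaf (Move [(2, 0), (6, 0)] (Last [(2, 1), (5,
      0)]) Leaf (Move [(2, 1), (5, 0)] Leaf Leaf Leaf (Last [(3, 1), (5, 1)])) (Last [(2,
      1), (5, 0)])) (Move [(1, 1), (6, 0)] Leaf Leaf (Move [(1, 0), (5, 0)] (Last [(1, 0),
      (4, 0)]) Leaf Leaf (Last [(2, 0), (4, 0)])) Leaf)),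
    ((8, 2, 1), Move [(1, 0), (8, 0)] (Last [(2, 0), (8, 0)]) Leaf (Move [(2, 0), (7, 0)]
      Leaf Leaf (Last [(3, 0), (6, 0)]) Leaf) Leaf),
    ((8, 3, 0), Move [(1, 0), (7, 0)] (Move [(2, 0), (6, 0)] Leaf Leaf (Move [(3, 0), (5,
      0)] Leaf Leaf Leaf (Last [(3, 1), (5, 1)])) (Last [(2, 1), (5, 0)])) Leaf (Move [(2,
      0), (6, 0)] (Move [(3, 0), (5, 0)] Leaf Leaf Leaf (Last [(3, 1), (5, 1)])) Leaf Leaf
      (Move [(3, 0), (5, 0)] (Last [(3, 1), (5, 1)]) Leaf Leaf Leaf)) (Move [(2, 0), (6, 0)]
      (Last [(2, 1), (5, 0)]) Leaf (Last [(2, 0), (5, 0)]) Leaf)),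
    ((8, 3, 1), Move [(1, 0), (7, 0)] (Move [(2, 0), (7, 0)] (Last [(3, 0), (7, 0)]) Leaf
      (Last [(3, 0), (6, 0)]) Leaf) Leaf (Move [(2, 0), (6, 0)] (Last [(2, 0), (5, 0)]) Leaf
      Leaf (Last [(3, 0), (5, 0)])) (Move [(2, 0), (6, 0)] Leaf Leaf (Move [(2, 1), (5, 0)]
      Leaf Leaf Leaf (Last [(3, 1), (5, 1)])) Leaf)),
    ((8, 4, 0), Move [(1, 0), (7, 0)] (Move [(2, 0), (6, 0)] (Move [(3, 0), (5, 0)] Leaf
      Leaf Leaf (Last [(3, 1), (5, 1)])) Leaf Leaf (Move [(3, 0), (5, 0)] (Last [(3, 1), (5,
      1)]) Leaf Leaf Leaf)) (Move [(2, 0), (6, 0)] Leaf Leaf Leaf (Last [(2, 1), (5, 0)]))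
      (Move [(2, 0), (6, 0)] Leaf Leaf Leaf (Last [(3, 0), (6, 1)])) (Move [(2, 0), (6, 0)]
      (Move [(3, 0), (5, 0)] (Last [(3, 1), (5, 1)]) Leaf Leaf Leaf) Leaf Leaf Leaf)),
    ((8, 4, 1), Move [(1, 0), (7, 0)] (Move [(2, 0), (6, 0)] (Move [(2, 0), (5, 0)] (Last
      [(2, 0), (4, 0)]) Leaf Leaf Leaf) Leaf Leaf (Last [(3, 0), (5, 0)])) (Last [(2, 0),
      (7, 0)]) (Last [(1, 0), (6, 0)]) (Move [(2, 0), (6, 0)] (Last [(3, 0), (5, 0)]) Leaf
      Leaf Leaf)),
    ((9, 1, 1), Last [(1, 0), (9, 0)]),
    ((9, 2, 0), Move [(1, 0), (8, 0)] Leaf Leaf (Move [(2, 0), (7, 0)] (Move [(2, 1), (6,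
      0)] Leaf Leaf (Last [(3, 1), (5, 0)]) Leaf) Leaf (Move [(2, 1), (6, 0)] (Last [(3, 1),
      (5, 0)]) Leaf Leaf (Last [(3, 1), (6, 0)])) (Move [(2, 1), (6, 0)] Leaf Leaf (Last
      [(2, 1), (5, 0)]) Leaf)) (Move [(1, 1), (7, 0)] Leaf Leaf (Move [(1, 0), (6, 0)] (Last
      [(2, 0), (5, 0)]) Leaf (Last [(1, 0), (5, 0)]) (Last [(2, 0), (5, 0)])) Leaf)),
    ((9, 2, 1), Move [(1, 0), (8, 0)] (Last [(2, 0), (8, 0)]) Leaf (Move [(2, 0), (7, 0)]
      Leaf Leaf (Last [(3, 0), (6, 0)]) Leaf) Leaf),
    ((9, 3, 0), Move [(1, 0), (8, 0)] (Move [(2, 0), (7, 0)] Leaf Leaf (Move [(3, 0), (6,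
      0)] (Last [(3, 1), (5, 0)]) Leaf Leaf (Last [(3, 1), (6, 0)])) (Move [(2, 1), (6, 0)]
      Leaf Leaf (Last [(2, 1), (5, 0)]) Leaf)) Leaf (Move [(2, 0), (7, 0)] (Move [(3, 0),
      (6, 0)] (Last [(3, 1), (5, 0)]) Leaf Leaf (Last [(3, 1), (6, 0)])) Leaf (Move [(3, 0),
      (6, 0)] Leaf Leaf Leaf (Last [(3, 1), (6, 1)])) (Move [(3, 0), (6, 0)] (Last [(3, 1),
      (6, 0)]) Leaf Leaf Leaf)) (Move [(2, 0), (7, 0)] (Move [(2, 1), (6, 0)] Leaf Leaf
      (Last [(2, 1), (5, 0)]) Leaf) Leaf (Last [(3, 0), (6, 0)]) Leaf)),
    ((9, 3, 1), Move [(1, 0), (8, 0)] (Move [(2, 0), (7, 0)] (Last [(3, 0), (7, 0)]) Leaf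
      (Last [(3, 0), (6, 0)]) Leaf) Leaf (Move [(2, 0), (7, 0)] (Last [(3, 0), (6, 0)]) Leaf
      (Last [(2, 0), (6, 0)]) (Last [(3, 0), (6, 0)])) (Move [(2, 0), (7, 0)] Leaf Leaf
      (Move [(2, 1), (6, 0)] (Last [(3, 1), (5, 0)]) Leaf Leaf (Last [(3, 1), (6, 0)]))
      Leaf)),
    ((9, 4, 0), Move [(1, 0), (8, 0)] (Move [(2, 0), (7, 0)] (Move [(3, 0), (6, 0)] Leaf
      Leaf Leaf (Last [(3, 1), (6, 0)])) Leaf (Move [(2, 0), (6, 0)] Leaf Leaf Leaf (Last
      [(3, 0), (6, 1)])) (Move [(3, 0), (6, 0)] (Last [(3, 1), (6, 0)]) Leaf Leaf Leaf))
      (Move [(2, 0), (7, 0)] Leaf Leaf Leaf (Move [(2, 1), (6, 0)] Leaf Leaf (Last [(2, 1),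
      (5, 0)]) Leaf)) (Move [(2, 0), (7, 0)] (Move [(2, 0), (6, 0)] Leaf Leaf Leaf (Last
      [(3, 0), (6, 1)])) Leaf Leaf (Move [(3, 0), (6, 0)] (Last [(3, 0), (6, 1)]) Leaf Leaf
      Leaf)) (Move [(2, 0), (7, 0)] (Move [(3, 0), (6, 0)] (Last [(3, 1), (6, 0)]) Leaf Leaf
      Leaf) Leaf (Last [(2, 0), (6, 0)]) Leaf)),
    ((9, 4, 1), Move [(1, 0), (8, 0)] (Move [(2, 0), (7, 0)] (Move [(3, 0), (6, 0)] (Last
      [(4, 0), (6, 0)]) Leaf Leaf Leaf) Leaf (Last [(2, 0), (6, 0)]) (Last [(3, 0), (6,
      0)])) (Last [(2, 0), (8, 0)]) (Move [(2, 0), (7, 0)] (Last [(2, 0), (6, 0)]) Leaf Leaf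
      (Last [(3, 0), (6, 0)])) (Move [(2, 0), (7, 0)] (Last [(3, 0), (6, 0)]) Leaf (Move
      [(3, 0), (6, 0)] Leaf Leaf Leaf (Last [(3, 1), (6, 1)])) Leaf))]"

lemma end_certs_valid:
  "\<forall>d\<in>set [0..<4]. \<forall>x\<in>set [0..<Suc d]. \<forall>\<rho>\<in>set [0..<2].
     chk d True [] [(d, 0)] (x, \<rho>) (lookup end_certs (d, x, \<rho>))"
  by code_simp

text \<open>The half of the gap next to the first cop suffices, since the other half is its
  reflection.\<close>

lemma gap_certs_valid:
  "\<forall>d\<in>set [1..<10]. \<forall>x\<in>set [0..<Suc (d div 2)]. \<forall>\<rho>\<in>set [0..<2].
     chk d False [] [(0, 0), (d, 0)] (x, \<rho>) (lookup gap_certs (d, x, \<rho>))"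
  by code_simp

section \<open>Placing certificate windows in the grid\<close>

definition window :: "nat \<Rightarrow> nat \<Rightarrow> bool \<Rightarrow> nat \<Rightarrow> bool \<Rightarrow> bool" where
  "window n D wall b up \<longleftrightarrow>
     (if up then b + D < n \<and> (wall \<longrightarrow> b = 0) else D \<le> b \<and> b < n \<and> (wall \<longrightarrow> b = n - 1))"

text \<open>The reflected placement serves the right end of the grid and the far half of a gap. Its
  subtraction is exact on the window, since \<open>window\<close> gives
  \<open>D \<le> b\<close>.\<close>

definition embed :: "nat \<Rightarrow> bool \<Rightarrow> place \<Rightarrow> place" where
  "embed b up p = (if up then b + fst p else b - fst p, snd p)"

definition edges_without :: "nat \<Rightarrow> nat \<Rightarrow> bool \<Rightarrow> (place \<times> place) list \<Rightarrow> place set set" where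
  "edges_without n b up R = edges (grid_2 n) - (\<lambda>(p, q). {embed b up p, embed b up q}) ` set R"

abbreviation inside :: "nat \<Rightarrow> place set" where
  "inside D \<equiv> {0..D} \<times> {0..<2}"

lemma embed_pair: "embed b up (x, \<rho>) = (if up then b + x else b - x, \<rho>)"
  by (simp add: embed_def)

lemma embed_inject:
  "window n D wall b up \<Longrightarrow> p \<in> inside D \<Longrightarrow> q \<in> inside D \<Longrightarrow> embed b up p = embed b up q \<longleftrightarrow> p = q"
  by (cases p; cases q) (auto simp: embed_def window_def split: if_splits)

lemma usable_inside: "usable D R p q \<Longrightarrow> p \<in> inside D \<Longrightarrow> q \<in> inside D"
  by (cases q) (auto simp: usable_def)

text \<open>Being injective on the window, the embedding cannot identify a usable edge with a
  deleted one.\<close>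

lemma usable_may_move:
  assumes "window n D wall b up" "set R \<subseteq> inside D \<times> inside D" "usable D R p q" "p \<in> inside D"
  shows "may_move (edges_without n b up R) (embed b up p) (embed b up q)"
proof (cases "p = q")
  case False
  have q: "q \<in> inside D" using assms usable_inside by blast
  have "{embed b up p, embed b up q} \<in> edges (grid_2 n)"
    using assms(1,3,4) False q by (cases p; cases q)
      (auto simp: embed_def window_def usable_def edge_grid split: if_splits)
  moreover have "{embed b up p, embed b up q} \<noteq> {embed b up p', embed b up q'}" if "(p', q') \<in> set R" for p' q'
  proof -
    have in': "p' \<in> inside D" "q' \<in> inside D" using that assms(2) by auto
    have "\<not> (p = p' \<and> q = q' \<or> p = q' \<and> q = p')"
      using that assms(3) False by (auto simp: usable_def)
    then show ?thesis
      using embed_inject[OF assms(1)] in' assms(4) q by (simp only: doubleton_eq_iff) simp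
  qed
  ultimately show ?thesis by (auto simp: may_move_def edges_without_def)
qed simp

lemma edges_without_Cons:
  "edges_without n b up R - {{embed b up p, embed b up q}} = edges_without n b up ((p, q) # R)"
  by (auto simp: edges_without_def)

lemma edges_without_stay: "edges_without n b up R - {{v, v}} = edges_without n b up R"
proof -
  have "{v, v} \<notin> edges (grid_2 n)" by (cases v) (simp only: edge_grid, simp)
  then show ?thesis by (auto simp: edges_without_def)
qed

text \<open>The conditions on \<open>x\<close> put all neighbours of the robber into the window:
  column \<open>Suc x\<close> is at most \<open>D\<close>, and if \<open>x = 0\<close> the grid ends
  there.\<close>

lemma robber_moves:
  assumes "window n D wall b up" "set R \<subseteq> inside D \<times> inside D" "(x, \<rho>) \<in> inside D" "x < D" "x = 0 \<longrightarrow> wall"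
    and v: "may_move (edges_without n b up R) (embed b up (x, \<rho>)) v"
  obtains "v = embed b up (x, \<rho>)"
    | q where "v = embed b up q" "usable D R (x, \<rho>) q"
        "q = (x - 1, \<rho>) \<and> x \<noteq> 0 \<or> q = (Suc x, \<rho>) \<or> q = (x, 1 - \<rho>)"
proof (cases "v = embed b up (x, \<rho>)")
  case False
  obtain a \<tau> where a: "v = (a, \<tau>)" by fastforce
  have e: "{embed b up (x, \<rho>), v} \<in> edges (grid_2 n)"
    "\<And>p q. (p, q) \<in> set R \<Longrightarrow> {embed b up (x, \<rho>), v} \<noteq> {embed b up p, embed b up q}"
    using v False by (auto simp: may_move_def edges_without_def)
  have "\<exists>q. v = embed b up q \<and> (q = (x - 1, \<rho>) \<and> x \<noteq> 0 \<or> q = (Suc x, \<rho>) \<or> q = (x, 1 - \<rho>))"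
  proof -
    let ?y = "if up then b + x else b - x"
    have "{(?y, \<rho>), (a, \<tau>)} \<in> edges (grid_2 n)" using e(1) by (cases up) (simp_all add: a embed_def)
    then consider "a = ?y" "\<tau> = 1 - \<rho>" | "\<tau> = \<rho>" "a = Suc ?y" "a < n" | "\<tau> = \<rho>" "?y = Suc a"
      unfolding edge_grid by fastforce
    then show ?thesis
    proof cases
      case 1
      then show ?thesis by (intro exI[of _ "(x, 1 - \<rho>)"]) (simp add: a embed_def)
    next
      case 2
      then show ?thesis
        using assms(1,4,5) by (intro exI[of _ "if up then (Suc x, \<rho>) else (x - 1, \<rho>)"])
          (auto simp: a embed_def window_def split: if_splits)
    next
      case 3
      then show ?thesis
        using assms(1,4,5) by (intro exI[of _ "if up then (x - 1, \<rho>) else (Suc x, \<rho>)"])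
          (auto simp: a embed_def window_def split: if_splits)
    qed
  qed
  then obtain q where q: "v = embed b up q" "q = (x - 1, \<rho>) \<and> x \<noteq> 0 \<or> q = (Suc x, \<rho>) \<or> q = (x, 1 - \<rho>)"
    by blast
  have "usable D R (x, \<rho>) q"
    using q assms(3,4) e(2)[of "(x, \<rho>)" q] e(2)[of q "(x, \<rho>)"]
    unfolding usable_def by (auto simp: insert_commute)
  with q show ?thesis using that(2) by blast
qed (use that in blast)

lemma forced_in_if_no_way_back:
  assumes w: "window n D wall b up" and R: "set R \<subseteq> inside D \<times> inside D"
    and cs: "set cs \<subseteq> inside D" and r: "(x, \<rho>) \<in> inside D"
    and c: "c \<in> set cs" "usable D R c (x, 1 - \<rho>)" and nwb: "no_way_back wall R (x, \<rho>) d"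
  shows "forced_in (Suc (Suc n)) (edges_without n b up R) (map (embed b up) cs) (embed b up (x, \<rho>))"
proof -
  let ?y = "if up then b + x else b - x"
  let ?S = "(\<lambda>(p, q). {embed b up p, embed b up q}) ` set R"
  have y: "?y < n" and \<rho>: "\<rho> < 2" using w r by (auto simp: window_def)
  have "forced_in (Suc (Suc n)) (edges (grid_2 n) - ?S) (map (embed b up) cs) (?y, \<rho>)"
  \<comment> \<open>A reflected window reverses directions, so flight in window direction
    \<open>d\<close> is flight in grid direction \<open>up = d\<close>.\<close>
  proof (rule forced_in_chase[where up = "up = d" and c = "embed b up c"])
    show "\<exists>v\<in>e. if up = d then fst v < ?y else ?y < fst v" if e: "e \<in> ?S" for e
    proof -
      obtain p q where pq: "(p, q) \<in> set R" "e = {embed b up p, embed b up q}" using e by auto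
      then have "p \<in> inside D" "q \<in> inside D" using R by auto
      moreover have "if d then fst p < x \<or> fst q < x else x < fst p \<or> x < fst q"
        using nwb pq(1) unfolding no_way_back_def by fastforce
      ultimately show ?thesis
        using w r unfolding pq(2) by (cases up; cases d) (auto simp: embed_def window_def)
    qed
    show "if up = d then ?y < y' else y' < ?y" if e: "{(y', \<rho>), (?y, \<rho>)} \<in> edges (grid_2 n) - ?S" for y'
    proof (rule ccontr)
      assume neg: "\<not> (if up = d then ?y < y' else y' < ?y)"
      have adj: "?y = Suc y' \<or> y' = Suc ?y" "y' < n" using e by (auto simp: edge_grid)
      define q where "q = (if d then x - 1 else Suc x, \<rho>)"
      \<comment> \<open>At window column 0 \<open>no_way_back\<close> requires the wall, and then
        the grid has no column behind the robber.\<close>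
      have x: "d \<longrightarrow> x \<noteq> 0"
        using neg adj nwb w by (auto simp: no_way_back_def window_def split: if_splits)
      then have "(q, (x, \<rho>)) \<in> set R \<or> ((x, \<rho>), q) \<in> set R"
        using nwb by (cases d) (simp_all add: no_way_back_def q_def)
      then have "{embed b up q, embed b up (x, \<rho>)} \<in> ?S"
      proof
        assume "(q, (x, \<rho>)) \<in> set R"
        then show ?thesis by (rule rev_image_eqI) simp
      next
        assume "((x, \<rho>), q) \<in> set R"
        then show ?thesis by (rule rev_image_eqI) (simp add: insert_commute)
      qed
      moreover have "embed b up q = (y', \<rho>)"
        using neg adj x w r by (cases up; cases d) (auto simp: embed_def window_def q_def)
      moreover have "embed b up (x, \<rho>) = (?y, \<rho>)" by (simp add: embed_def)
      ultimately show False using e by simp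
    qed
    have "may_move (edges_without n b up R) (embed b up c) (embed b up (x, 1 - \<rho>))"
      using usable_may_move[OF w R c(2)] c(1) cs by blast
    then show "may_move (edges (grid_2 n) - ?S) (embed b up c) (?y, 1 - \<rho>)"
      by (simp add: edges_without_def embed_pair)
  qed (use y \<rho> c in auto)
  then show ?thesis by (simp add: edges_without_def embed_pair)
qed

text \<open>Soundness of certificates: at most \<open>size t\<close> rounds lead to a leaf, and
  \<open>Suc (Suc n)\<close> rounds suffice for the final capture or chase.\<close>

lemma forced_in_if_chk:
  assumes w: "window n D wall b up"
  shows "chk D wall R cs r t \<Longrightarrow> set R \<subseteq> inside D \<times> inside D \<Longrightarrow> set cs \<subseteq> inside D \<Longrightarrow>
    r \<in> inside D \<Longrightarrow>
    forced_in (size t + Suc (Suc n)) (edges_without n b up R) (map (embed b up) cs) (embed b up r)"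
proof (induction t arbitrary: R cs r)
  case Leaf
  obtain x \<rho> where r: "r = (x, \<rho>)" by fastforce
  from Leaf.prems(1) consider c where "c \<in> set cs" "usable D R c r"
    | c d where "c \<in> set cs" "usable D R c (x, 1 - \<rho>)" "no_way_back wall R (x, \<rho>) d"
    unfolding r by auto
  then show ?case
  proof cases
    case 1
    then have "may_move (edges_without n b up R) (embed b up c) (embed b up r)"
      using usable_may_move[OF w Leaf.prems(2)] Leaf.prems(3) by blast
    then show ?thesis
      using 1(1) forced_in_capture[of "embed b up c" "map (embed b up) cs" _ _ "Suc n"] by simp
  next
    case 2
    then show ?thesis
      using forced_in_if_no_way_back[OF w Leaf.prems(2,3)] Leaf.prems(4) by (simp add: r)
  qed
next
  case (Move cs' t0 t1 t2 t3)
  obtain x \<rho> where r: "r = (x, \<rho>)" by fastforce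
  let ?E = "edges_without n b up R" and ?m = "size t0 + size t1 + size t2 + size t3 + Suc (Suc n)"
  have move: "list_all2 (usable D R) cs cs'" and x: "x < D" "x = 0 \<longrightarrow> wall"
    using Move.prems(1) by (auto simp: r)
  have cs': "set cs' \<subseteq> inside D"
  proof
    fix c' assume "c' \<in> set cs'"
    then obtain i where i: "i < length cs'" "c' = cs' ! i" by (metis in_set_conv_nth)
    then have "usable D R (cs ! i) c'" "cs ! i \<in> inside D"
      using list_all2_nthD2[OF move] list_all2_lengthD[OF move] Move.prems(3) by (auto dest: nth_mem)
    then show "c' \<in> inside D" by (rule usable_inside)
  qed
  have "forced_in (Suc ?m) ?E (map (embed b up) cs) (embed b up r)"
  proof (rule forced_inI)
    show "list_all2 (may_move ?E) (map (embed b up) cs) (map (embed b up) cs')"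
    proof (rule list_all2_all_nthI)
      show "length (map (embed b up) cs) = length (map (embed b up) cs')"
        using list_all2_lengthD[OF move] by simp
      show "may_move ?E (map (embed b up) cs ! i) (map (embed b up) cs' ! i)"
        if "i < length (map (embed b up) cs)" for i
      proof -
        have "cs ! i \<in> inside D" using that Move.prems(3) nth_mem[of i cs] by auto
        then show ?thesis
          using that list_all2_lengthD[OF move] list_all2_nthD[OF move, of i]
            usable_may_move[OF w Move.prems(2)] by simp
      qed
    qed
  next
    fix v
    assume v: "may_move ?E (embed b up r) v" "v \<notin> set (map (embed b up) cs')"
    have "forced_in ?m (?E - {{embed b up r, v}}) (map (embed b up) cs') v"
      using w Move.prems(2) Move.prems(4)[unfolded r] x v(1)[unfolded r]
    proof (cases rule: robber_moves)
      case 1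
      have "r \<notin> set cs'" using v(2) 1 by (auto simp: r)
      then have "chk D wall R cs' r t0" using Move.prems(1) by simp
      then have "forced_in (size t0 + Suc (Suc n)) ?E (map (embed b up) cs') (embed b up r)"
        using Move.IH(1) Move.prems(2,4) cs' by blast
      then show ?thesis
        unfolding 1 r edges_without_stay by (rule forced_in_mono) simp
    next
      case (2 q)
      have "q \<notin> set cs'" using v(2) 2(1) by auto
      have q: "q \<in> inside D" using usable_inside[OF 2(2)] Move.prems(4) by (simp add: r)
      obtain t where t: "t \<in> {t1, t2, t3}" "chk D wall ((r, q) # R) cs' q t"
        using Move.prems(1) 2(2,3) \<open>q \<notin> set cs'\<close> unfolding r by (auto simp: Let_def split: if_splits)
      have "set ((r, q) # R) \<subseteq> inside D \<times> inside D"
        using Move.prems(2,4) q by auto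
      then have "forced_in (size t + Suc (Suc n)) (edges_without n b up ((r, q) # R))
          (map (embed b up) cs') (embed b up q)"
        using t Move.IH(2-4) cs' q by blast
      then show ?thesis
        unfolding 2(1) edges_without_Cons by (rule forced_in_mono) (use t(1) in auto)
    qed
    then show "forced_in ?m (?E - {{embed b up r, v}}) (map (embed b up) cs') v" .
  qed
  then show ?case by (rule forced_in_mono) simp
qed

section \<open>The value of the cop number\<close>

lemma forced_in_grid_if_chk:
  assumes "window n D wall b up" "chk D wall [] cs r t" "set cs \<subseteq> inside D" "r \<in> inside D"
  shows "\<exists>m. forced_in m (edges (grid_2 n)) (xs @ map (embed b up) cs @ ys) (embed b up r)"
proof -
  have "forced_in (size t + Suc (Suc n)) (edges_without n b up []) (map (embed b up) cs) (embed b up r)"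
    by (rule forced_in_if_chk[OF assms(1,2) _ assms(3,4)]) simp
  then show ?thesis
    unfolding edges_without_def by (auto intro: forced_in_append simp del: forced_in.simps)
qed

lemma end_chk:
  assumes "d < 4" "x \<le> d" "\<rho> < 2"
  shows "chk d True [] [(d, 0)] (x, \<rho>) (lookup end_certs (d, x, \<rho>))"
  by (rule end_certs_valid[rule_format]) (use assms in auto)

lemma gap_chk:
  assumes "1 \<le> d" "d < 10" "x \<le> d div 2" "\<rho> < 2"
  shows "chk d False [] [(0, 0), (d, 0)] (x, \<rho>) (lookup gap_certs (d, x, \<rho>))"
  by (rule gap_certs_valid[rule_format]) (use assms in auto)

lemma cops_win_grid:
  assumes n: "1 \<le> n" "n + 2 \<le> 9 * k"
  shows "cops_win (grid_2 n) k"
proof -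
  \<comment> \<open>The minimum moves a cop who would be beyond the grid to its last column. In the
    last gap to the right end, \<open>n + 2 \<le> 9 * k\<close> leaves at most 3 columns.\<close>
  define p where "p i = min (9 * i + 3) (n - 1)" for i :: nat
  define place where "place i = (p i, 0 :: nat)" for i
  have k: "1 \<le> k" using n by linarith
  have p_less: "p i < n" for i using n by (auto simp: p_def)
  have p_step: "p (Suc i) \<le> p i + 9" for i by (auto simp: p_def)
  have p_first: "p 0 < 4" by (simp add: p_def)
  have p_last: "n - 1 - p (k - 1) < 4" using n k unfolding p_def by linarith
  show ?thesis
  proof (rule cops_win_if_forced)
    show "length (map place [0..<k]) = k" by simp
    show "set (map place [0..<k]) \<subseteq> verts (grid_2 n)"
      using p_less by (auto simp: place_def)
    show "finite (verts (grid_2 n))" by simp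
    fix r
    assume "r \<in> verts (grid_2 n)"
    then obtain x \<rho> where r: "r = (x, \<rho>)" "x < n" "\<rho> < 2" by auto
    consider "x \<le> p 0" | "p (k - 1) \<le> x" | "p 0 < x" "x < p (k - 1)" by linarith
    then show "\<exists>m. forced_in m (edges (grid_2 n)) (map place [0..<k]) r"
    proof cases
      case 1
      have "map place [0..<k] = [] @ map (embed 0 True) [(p 0, 0)] @ map place [1..<k]"
        using k by (simp add: upt_rec place_def embed_def)
      moreover have "r = embed 0 True (x, \<rho>)" by (simp add: r embed_def)
      moreover have "window n (p 0) True 0 True" using p_less by (simp add: window_def)
      ultimately show ?thesis
        using forced_in_grid_if_chk[OF _ end_chk[OF p_first 1 r(3)], of n 0 True "[]" "map place [1..<k]"]
          1 r by simp
    next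
      case 2
      define d where "d = n - 1 - p (k - 1)"
      have "[0..<k] = [0..<k - 1] @ [k - 1]"
        using k by (metis Suc_pred' le_eq_less_or_eq less_one not_less upt_Suc_append zero_le)
      moreover have "n - 1 - d = p (k - 1)" using p_less[of "k - 1"] by (simp add: d_def)
      ultimately have "map place [0..<k] =
          map place [0..<k - 1] @ map (embed (n - 1) False) [(d, 0)] @ []"
        by (simp add: place_def embed_def)
      moreover have "r = embed (n - 1) False (n - 1 - x, \<rho>)" using r by (simp add: embed_def)
      moreover have "window n d True (n - 1) False" using n by (simp add: window_def d_def)
      moreover have x: "d < 4" "n - 1 - x \<le> d" using 2 p_last by (auto simp: d_def)
      ultimately show ?thesis
        using forced_in_grid_if_chk[OF _ end_chk[OF x r(3)], of n "n - 1" False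
            "map place [0..<k - 1]" "[]"] r by simp
    next
      case 3
      \<comment> \<open>The first cop not left of the robber. He and his predecessor enclose the
        robber.\<close>
      define j where "j = (LEAST j. x \<le> p j)"
      have j: "x \<le> p j" unfolding j_def by (rule LeastI[of _ "k - 1"]) (use 3 in simp)
      have "j \<noteq> 0" using j 3 by (cases j) auto
      then obtain i where i: "j = Suc i" by (cases j) auto
      have "\<not> x \<le> p i" using not_less_Least[of i "\<lambda>j. x \<le> p j"] i by (simp add: j_def)
      moreover have "j \<le> k - 1" unfolding j_def by (rule Least_le) (use 3 in simp)
      ultimately have px: "p i < x" "x \<le> p (Suc i)" and ik: "Suc i < k"
        using j i k by auto
      define d where "d = p (Suc i) - p i"
      have d: "1 \<le> d" "d < 10" using px p_step[of i] by (auto simp: d_def)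
      have "[0..<k] = [0..<i] @ [i, Suc i] @ [Suc (Suc i)..<k]"
        using ik upt_add_eq_append[of 0 i "k - i"] by (simp add: upt_rec)
      then have cs: "map place [0..<k] =
          map place [0..<i] @ [place i, place (Suc i)] @ map place [Suc (Suc i)..<k]"
        by simp
      show ?thesis
      proof (cases "x - p i \<le> d div 2")
        case True
        have "[place i, place (Suc i)] = map (embed (p i) True) [(0, 0), (d, 0)]"
          using px by (simp add: place_def embed_def d_def)
        moreover have "r = embed (p i) True (x - p i, \<rho>)" using px r by (simp add: embed_def)
        moreover have "window n d False (p i) True"
          using px p_less[of "Suc i"] by (simp add: window_def d_def)
        ultimately show ?thesis
          using forced_in_grid_if_chk[OF _ gap_chk[OF d True r(3)], of n "p i" True
              "map place [0..<i]" "map place [Suc (Suc i)..<k]"] True r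
          unfolding cs by simp
      next
        case False
        then have x: "p (Suc i) - x \<le> d div 2" using px by (simp add: d_def)
        \<comment> \<open>Column 0 of the reflected window is at the right-hand cop, so the
          certificate lists the two cops in reverse order.\<close>
        have "rev [place i, place (Suc i)] = map (embed (p (Suc i)) False) [(0, 0), (d, 0)]"
          using px by (simp add: place_def embed_def d_def)
        moreover have "r = embed (p (Suc i)) False (p (Suc i) - x, \<rho>)" using px r by (simp add: embed_def)
        moreover have "window n d False (p (Suc i)) False"
          using px p_less[of "Suc i"] by (simp add: window_def d_def)
        ultimately have "\<exists>m. forced_in m (edges (grid_2 n)) ([] @ rev [place i, place (Suc i)] @ []) r"
          using forced_in_grid_if_chk[OF _ gap_chk[OF d x r(3)], of n "p (Suc i)" False "[]" "[]"] x r
          by simp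
        then have "\<exists>m. forced_in m (edges (grid_2 n)) [place i, place (Suc i)] r"
          unfolding append_Nil append_Nil2 forced_in_rev .
        then show ?thesis
          unfolding cs by (elim exE) (rule exI, rule forced_in_append)
      qed
    qed
  qed
qed

theorem theorem4p3:
  fixes n :: nat
  assumes "n \<ge> 1"
  shows "int (bb_cop_number (grid_2 n)) = \<lceil>(real n + 2) / 9\<rceil>"
proof -
  \<comment> \<open>This is the ceiling of \<open>(n + 2) / 9\<close> in integer arithmetic.\<close>
  define k where "k = (n + 10) div 9"
  have k: "n + 2 \<le> 9 * k" "9 * k \<le> n + 10" unfolding k_def by linarith+
  have "bb_cop_number (grid_2 n) = k"
    unfolding bb_cop_number_def
  proof (rule Least_equality)
    show "cops_win (grid_2 n) k" using assms k by (intro cops_win_grid)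
    show "k \<le> l" if "cops_win (grid_2 n) l" for l
    proof (rule ccontr)
      assume "\<not> k \<le> l"
      \<comment> \<open>From \<open>l \<le> k - 1\<close> follows
        \<open>9 * l \<le> 9 * k - 9\<close>, exactly the bound for which the robber
        escapes.\<close>
      then have "9 * l \<le> n + 1" using k by linarith
      then show False using not_cops_win_grid[OF assms] that by blast
    qed
  qed
  moreover have "\<lceil>(real n + 2) / 9\<rceil> = int k"
  proof (rule ceiling_unique)
    have "real (n + 2) \<le> real (9 * k)" "real (9 * k) \<le> real (n + 10)"
      using k by (simp_all only: of_nat_le_iff)
    then show "real_of_int (int k) - 1 < (real n + 2) / 9" "(real n + 2) / 9 \<le> real_of_int (int k)"
      by simp_all
  qed
  ultimately show ?thesis by simp
qed

end
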